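(* Let $\mathcal{M}$ be either the minority process or the majority process. There is an algorithm that, given a finite tree $T$ with $n$ nodes and maximal node degree $\Delta$, computes both the number of fixed points of $\mathcal{M}$ on $T$ and the number of pure 2-cycles of $\mathcal{M}$ on $T$ in time $O(n\Delta)$.
   Context: Let $T=(V,E)$ be a finite undirected tree. A coloring is a map $c:V\to\{0,1\}$. For a node $v$ and $i\in\{0,1\}$ let $N^i(v)$ be the set of neighbors $u$ of $v$ with $c(u)=i$. The minority process maps $c$ to $\mathcal{MIN}(c)$, where $\mathcal{MIN}(c)(v)=c(v)$ if $|N^{c(v)}(v)|\le |N^{1-c(v)}(v)|$ and $\mathcal{MIN}(c)(v)=1-c(v)$ if $|N^{c(v)}(v)|> |N^{1-c(v)}(v)|$, simultaneously for all nodes $v$. The majority process $\mathcal{MAJ}$ is defined in the same way with the comparisons reversed: $\mathcal{MAJ}(c)(v)=c(v)$ if $|N^{c(v)}(v)|\ge |N^{1-c(v)}(v)|$ and $1-c(v)$ otherwise. A coloring $c$ is a fixed point of $\mathcal{M}$ if $\mathcal{M}(c)=c$; it is a pure 2-cycle if $\mathcal{M}(c)(v)\neq c(v)$ for every node $v$ and $\mathcal{M}(\mathcal{M}(c))=c$. Running time is measured counting arithmetic operations on integers as unit-cost operations. *)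

theory Defs
  imports Main "HOL-Library.FuncSet"
begin

section \<open>Trees\<close>

text \<open>An undirected simple graph is given by its node set \<open>V\<close> and its edge set \<open>E\<close>,
  a set of two-element subsets of \<open>V\<close>.\<close>

definition simple_graph :: "'a set \<Rightarrow> 'a set set \<Rightarrow> bool" where
  "simple_graph V E \<longleftrightarrow> finite V \<and> (\<forall>e\<in>E. e \<subseteq> V \<and> card e = 2)"

definition connected_graph :: "'a set \<Rightarrow> 'a set set \<Rightarrow> bool" where
  "connected_graph V E \<longleftrightarrow> V \<noteq> {} \<and> (\<forall>u\<in>V. \<forall>v\<in>V. (u, v) \<in> {(x, y). {x, y} \<in> E}\<^sup>*)"

definition is_cycle :: "'a set set \<Rightarrow> 'a list \<Rightarrow> bool" where
  "is_cycle E xs \<longleftrightarrow> length xs \<ge> 3 \<and> distinct xs \<and>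
     (\<forall>i < length xs. {xs ! i, xs ! (Suc i mod length xs)} \<in> E)"

definition is_tree :: "'a set \<Rightarrow> 'a set set \<Rightarrow> bool" where
  "is_tree V E \<longleftrightarrow> simple_graph V E \<and> connected_graph V E \<and> (\<nexists>xs. is_cycle E xs)"

definition neighbors :: "'a set set \<Rightarrow> 'a \<Rightarrow> 'a set" where
  "neighbors E v = {u. {u, v} \<in> E}"

definition max_degree :: "'a set \<Rightarrow> 'a set set \<Rightarrow> nat" where
  "max_degree V E = Max ((\<lambda>v. card (neighbors E v)) ` V)"


section \<open>The minority and the majority process\<close>

text \<open>A coloring of \<open>V\<close> is an element of \<open>V \<rightarrow>\<^sub>E {0, 1}\<close>. Outside \<open>V\<close> it takes the
  value \<open>undefined\<close>, so that colorings can be compared and counted as functions.\<close>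

type_synonym 'a coloring = "'a \<Rightarrow> nat"

definition colorings :: "'a set \<Rightarrow> 'a coloring set" where
  "colorings V = V \<rightarrow>\<^sub>E {0, 1}"

definition color_neighbors :: "'a set set \<Rightarrow> 'a coloring \<Rightarrow> nat \<Rightarrow> 'a \<Rightarrow> 'a set" where
  "color_neighbors E c i v = {u \<in> neighbors E v. c u = i}"

definition minority :: "'a set \<Rightarrow> 'a set set \<Rightarrow> 'a coloring \<Rightarrow> 'a coloring" where
  "minority V E c = (\<lambda>v\<in>V.
     if card (color_neighbors E c (c v) v) \<le> card (color_neighbors E c (1 - c v) v)
     then c v else 1 - c v)"

definition majority :: "'a set \<Rightarrow> 'a set set \<Rightarrow> 'a coloring \<Rightarrow> 'a coloring" where
  "majority V E c = (\<lambda>v\<in>V.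
     if card (color_neighbors E c (c v) v) \<ge> card (color_neighbors E c (1 - c v) v)
     then c v else 1 - c v)"

definition fixed_points :: "'a set \<Rightarrow> ('a coloring \<Rightarrow> 'a coloring) \<Rightarrow> 'a coloring set" where
  "fixed_points V F = {c \<in> colorings V. F c = c}"

definition pure_two_cycles :: "'a set \<Rightarrow> ('a coloring \<Rightarrow> 'a coloring) \<Rightarrow> 'a coloring set" where
  "pure_two_cycles V F = {c \<in> colorings V. (\<forall>v\<in>V. F c v \<noteq> c v) \<and> F (F c) = c}"


section \<open>Algorithms and their running time\<close>

text \<open>Algorithms are while-programs of a random access machine with unit cost. The memory
  consists of named arrays of integers of unbounded size; a fixed program only accesses
  finitely many of them. Scalar variables are represented by entry \<open>0\<close> of an array.
  The operations on integers are addition, subtraction, multiplication and comparison.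
  Every evaluation of a constant, array access, arithmetic operation, comparison,
  Boolean connective and every executed command takes one unit of time.\<close>

type_synonym state = "string \<Rightarrow> int \<Rightarrow> int"

datatype aexp =
    Const int
  | Read string aexp
  | Plus aexp aexp
  | Minus aexp aexp
  | Times aexp aexp

datatype bexp = Less aexp aexp | Not bexp | And bexp bexp

datatype com =
    Skip
  | Write string aexp aexp  \<comment> \<open>array, index, value\<close>
  | Seq com com
  | If bexp com com
  | While bexp com

fun aval :: "aexp \<Rightarrow> state \<Rightarrow> int" where
  "aval (Const k) s = k"
| "aval (Read x i) s = s x (aval i s)"
| "aval (Plus a b) s = aval a s + aval b s"
| "aval (Minus a b) s = aval a s - aval b s"
| "aval (Times a b) s = aval a s * aval b s"

fun acost :: "aexp \<Rightarrow> nat" where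
  "acost (Const k) = 1"
| "acost (Read x i) = 1 + acost i"
| "acost (Plus a b) = 1 + acost a + acost b"
| "acost (Minus a b) = 1 + acost a + acost b"
| "acost (Times a b) = 1 + acost a + acost b"

fun bval :: "bexp \<Rightarrow> state \<Rightarrow> bool" where
  "bval (Less a b) s \<longleftrightarrow> aval a s < aval b s"
| "bval (Not b) s \<longleftrightarrow> \<not> bval b s"
| "bval (And b b') s \<longleftrightarrow> bval b s \<and> bval b' s"

fun bcost :: "bexp \<Rightarrow> nat" where
  "bcost (Less a b) = 1 + acost a + acost b"
| "bcost (Not b) = 1 + bcost b"
| "bcost (And b b') = 1 + bcost b + bcost b'"

text \<open>\<open>exec p s t s'\<close>: started in state \<open>s\<close>, the program \<open>p\<close> terminates after \<open>t\<close> units of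
  time in state \<open>s'\<close>.\<close>

inductive exec :: "com \<Rightarrow> state \<Rightarrow> nat \<Rightarrow> state \<Rightarrow> bool" where
  Skip: "exec Skip s 1 s"
| Write: "exec (Write x i a) s (1 + acost i + acost a) (s(x := (s x)(aval i s := aval a s)))"
| Seq: "exec p s t s' \<Longrightarrow> exec q s' t' s'' \<Longrightarrow> exec (Seq p q) s (1 + t + t') s''"
| IfTrue: "bval b s \<Longrightarrow> exec p s t s' \<Longrightarrow> exec (If b p q) s (1 + bcost b + t) s'"
| IfFalse: "\<not> bval b s \<Longrightarrow> exec q s t s' \<Longrightarrow> exec (If b p q) s (1 + bcost b + t) s'"
| WhileFalse: "\<not> bval b s \<Longrightarrow> exec (While b p) s (1 + bcost b) s"
| WhileTrue: "bval b s \<Longrightarrow> exec p s t s' \<Longrightarrow> exec (While b p) s' t' s'' \<Longrightarrow>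
    exec (While b p) s (1 + bcost b + t + t') s''"

inductive_cases Skip_elim: "exec Skip s t s'"
inductive_cases Write_elim: "exec (Write x i a) s t s'"
inductive_cases Seq_elim: "exec (Seq p q) s t s'"
inductive_cases If_elim: "exec (If b p q) s t s'"
inductive_cases While_elim: "exec (While b p) s t s'"

lemma exec_deterministic:
  "exec p s t s' \<Longrightarrow> exec p s u s'' \<Longrightarrow> t = u \<and> s' = s''"
proof (induction arbitrary: u s'' rule: exec.induct)
  case (Seq p s t s' q t' s2)
  from Seq.prems obtain v r v' where u: "u = Suc (v + v')"
    and p: "exec p s v r" and q: "exec q r v' s''"
    by (blast elim: Seq_elim)
  from Seq.IH(1)[OF p] have "t = v" "s' = r" by auto
  with Seq.IH(2) q u show ?case by auto
next
  case (WhileTrue b s p t s' t' s2)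
  from WhileTrue.prems WhileTrue.hyps(1) obtain v r v' where u: "u = Suc (bcost b + v + v')"
    and p: "exec p s v r" and q: "exec (While b p) r v' s''"
    by (blast elim: While_elim)
  from WhileTrue.IH(1)[OF p] have "t = v" "s' = r" by auto
  with WhileTrue.IH(2) q u show ?case by auto
next
  case (IfTrue b s p t s' q)
  from IfTrue.prems IfTrue.hyps(1) obtain v where u: "u = Suc (bcost b + v)" and p: "exec p s v s''"
    by (blast elim: If_elim)
  from IfTrue.IH[OF p] u show ?case by auto
next
  case (IfFalse b s q t s' p)
  from IfFalse.prems IfFalse.hyps(1) obtain v where u: "u = Suc (bcost b + v)" and q: "exec q s v s''"
    by (blast elim: If_elim)
  from IfFalse.IH[OF q] u show ?case by auto
next
  case (WhileFalse b s p)
  from WhileFalse.prems show ?case by (rule While_elim) (use WhileFalse.hyps in simp_all)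
next
  case (Skip s)
  from Skip.prems show ?case by (rule Skip_elim) simp
next
  case (Write x i a s)
  from Write.prems show ?case by (rule Write_elim) simp
qed

text \<open>The input graph has the nodes \<open>0, \<dots>, n - 1\<close> and is given by \<open>n\<close> and a list of its edges:
  every edge occurs exactly once, the order of the edges and of the two end points of an
  edge is arbitrary.\<close>

definition edge_list :: "'a set set \<Rightarrow> ('a \<times> 'a) list \<Rightarrow> bool" where
  "edge_list E es \<longleftrightarrow>
     distinct (map (\<lambda>(u, v). {u, v}) es) \<and> set (map (\<lambda>(u, v). {u, v}) es) = E"

definition array_of :: "nat list \<Rightarrow> int \<Rightarrow> int" where
  "array_of xs i = (if 0 \<le> i \<and> nat i < length xs then int (xs ! nat i) else 0)"

definition input_state :: "nat \<Rightarrow> (nat \<times> nat) list \<Rightarrow> state" where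
  "input_state n es = (\<lambda>x i. 0)
     (''nodes'' := array_of [n],
      ''source'' := array_of (map fst es),
      ''target'' := array_of (map snd es))"

end

theory Submission imports Defs
begin

text \<open>A coloring is a fixed point, or is flipped everywhere, iff every node \<open>v\<close> has at least
  \<open>(deg v + \<theta>) / 2\<close> good neighbors, where \<open>\<theta>\<close> is \<open>0\<close> or \<open>1\<close> and good means either ``of the same
  color'' or ``of the other color''. So it suffices to evaluate the sum over all colorings of
  \<open>\<Prod>v. f v (number of good neighbors of v)\<close>, where \<open>f v m\<close> is \<open>1\<close> if \<open>2 m \<ge> deg v + \<theta>\<close> and \<open>0\<close>
  otherwise. Of the two colors of a leaf \<open>v\<close> with neighbor \<open>u\<close>, one makes the edge good and the
  other does not. Hence the sum does not change when \<open>v\<close> is removed and \<open>f u m\<close> is replaced by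
  \<open>f v 0 * f u m + f v 1 * f u (m + 1)\<close>, which takes time \<open>O(\<Delta>)\<close>; for a single node \<open>r\<close> the sum
  is \<open>2 * f r 0\<close>. Leaves are found in linear time without adjacency lists: keeping for
  every node its degree and the sum of its neighbors, one reads off the neighbor of a leaf. When
  the removal of a leaf makes its neighbor a leaf, that one is removed next; otherwise the scan of
  \<open>0, \<dots>, n - 1\<close> goes on.\<close>

section \<open>Pruning leaves of a tree\<close>

lemma neighbors_insert:
  assumes "a \<noteq> b"
  shows "neighbors (insert {a, b} F) x =
    (if x = a then insert b (neighbors F x) else if x = b then insert a (neighbors F x)
     else neighbors F x)"
  using assms by (auto simp: neighbors_def doubleton_eq_iff)

lemma not_mem_neighbors: "{a, b} \<notin> F \<Longrightarrow> a \<notin> neighbors F b" "{a, b} \<notin> F \<Longrightarrow> b \<notin> neighbors F a"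
  by (auto simp: neighbors_def insert_commute)

lemma neighbors_subset:
  assumes "simple_graph V E"
  shows "neighbors E x \<subseteq> V - {x}"
proof
  fix y assume "y \<in> neighbors E x"
  then have "{y, x} \<in> E" by (simp add: neighbors_def)
  with assms have "{y, x} \<subseteq> V" "card {y, x} = 2" by (auto simp: simple_graph_def)
  then show "y \<in> V - {x}" by (cases "y = x") auto
qed

lemma finite_neighbors: "simple_graph V E \<Longrightarrow> finite (neighbors E x)"
  by (meson finite_Diff finite_subset neighbors_subset simple_graph_def)

lemma neighbors_mono: "F \<subseteq> E \<Longrightarrow> neighbors F x \<subseteq> neighbors E x"
  by (auto simp: neighbors_def)

lemma simple_graph_edgeE:
  assumes "simple_graph V E" "e \<in> E"
  obtains a b where "e = {a, b}" "a \<noteq> b" "a \<in> V" "b \<in> V"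
  using assms unfolding simple_graph_def by (metis card_2_iff insert_subset)

lemma finite_edges: "simple_graph V E \<Longrightarrow> finite E"
  unfolding simple_graph_def by (rule finite_subset[of E "Pow V"]) auto

text \<open>The last node of a longest path has no neighbor outside the path, and a second neighbor
  on the path closes a cycle.\<close>

lemma exists_leaf:
  assumes g: "simple_graph V E" and acyc: "\<nexists>xs. is_cycle E xs" and "E \<noteq> {}"
  shows "\<exists>v. card (neighbors E v) = 1"
proof (rule ccontr)
  assume no: "\<nexists>v. card (neighbors E v) = 1"
  define path where "path xs \<longleftrightarrow> distinct xs \<and> set xs \<subseteq> V \<and> 2 \<le> length xs \<and>
    (\<forall>i. Suc i < length xs \<longrightarrow> {xs ! i, xs ! Suc i} \<in> E)" for xs
  from \<open>E \<noteq> {}\<close> g obtain a b where ab: "{a, b} \<in> E" "a \<noteq> b" "a \<in> V" "b \<in> V"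
    by (metis ex_in_conv simple_graph_edgeE)
  then have "path [a, b]" by (auto simp: path_def nth_Cons split: nat.splits)
  moreover have "length xs \<le> card V" if "path xs" for xs
    using that g unfolding path_def simple_graph_def by (metis card_mono distinct_card)
  ultimately obtain xs where xs: "path xs" and max: "\<And>ys. path ys \<Longrightarrow> length ys \<le> length xs"
    using ex_has_greatest_nat[of path "[a, b]" length "Suc (card V)"] le_imp_less_Suc by blast
  define k where "k = length xs - 2"
  have k: "length xs = Suc (Suc k)" using xs by (auto simp: path_def k_def)
  let ?z = "xs ! Suc k" and ?y = "xs ! k"
  have yz: "?y \<in> neighbors E ?z" using xs k by (auto simp: path_def neighbors_def)
  then have "card (neighbors E ?z) \<noteq> 0" using finite_neighbors[OF g] by auto
  with no have "neighbors E ?z \<noteq> {?y}" by (metis card_1_singleton_iff One_nat_def)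
  with yz obtain w where w: "w \<in> neighbors E ?z" "w \<noteq> ?y" by blast
  have wV: "w \<in> V" "w \<noteq> ?z" using neighbors_subset[OF g] w(1) by blast+
  show False
  proof (cases "w \<in> set xs")
    case False
    have "path (xs @ [w])"
      using xs False wV w k by (auto simp: path_def nth_append neighbors_def insert_commute less_Suc_eq)
    from max[OF this] show False by simp
  next
    case True
    then obtain j where j: "j < length xs" "xs ! j = w" by (auto simp: in_set_conv_nth)
    \<comment> \<open>\<open>w\<close> is neither the last node of the path nor its predecessor, so
      the piece from index \<open>j\<close> on has at least three nodes, as a cycle
      requires.\<close>
    with k w wV have jk: "j < k" by (metis less_antisym not_less_eq)
    have "is_cycle E (drop j xs)" unfolding is_cycle_def
    proof (intro conjI allI impI)
      show "3 \<le> length (drop j xs)" using jk k by simp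
      show "distinct (drop j xs)" using xs by (simp add: path_def)
      fix i assume i: "i < length (drop j xs)"
      show "{drop j xs ! i, drop j xs ! (Suc i mod length (drop j xs))} \<in> E"
      proof (cases "Suc i = length (drop j xs)")
        case True
        then have "j + i = Suc k" using k jk by simp
        with True w(1) j(2) j(1) show ?thesis by (simp add: neighbors_def insert_commute)
      next
        case False
        with i have "Suc i < length (drop j xs)" by simp
        with xs j(1) show ?thesis by (simp add: path_def)
      qed
    qed
    with acyc show False by blast
  qed
qed

text \<open>The edge \<open>{u, v}\<close> is the only one at \<open>v\<close>, so dropping
  \<open>v\<close> loses no other edge. This is the step that all inductions over trees and the
  pruning loop use.\<close>

lemma is_tree_prune:
  assumes t: "is_tree V E" and v: "neighbors E v = {u}"
  shows "is_tree (V - {v}) (E - {{u, v}})" "u \<in> V - {v}" "v \<in> V" "{u, v} \<in> E"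
proof -
  have g: "simple_graph V E" and co: "connected_graph V E" and acyc: "\<nexists>xs. is_cycle E xs"
    using t by (auto simp: is_tree_def)
  show uV: "u \<in> V - {v}" using neighbors_subset[OF g, of v] v by auto
  show uv: "{u, v} \<in> E" using v by (auto simp: neighbors_def)
  then show vV: "v \<in> V" using g by (auto simp: simple_graph_def)
  have only: "e = {u, v}" if "e \<in> E" "v \<in> e" for e
  proof -
    from g that(1) obtain a b where "e = {a, b}" by (rule simple_graph_edgeE)
    with that(2) obtain w where w: "e = {w, v}" by (metis insert_iff insert_commute empty_iff)
    with that(1) have "w \<in> neighbors E v" by (simp add: neighbors_def)
    with v w show ?thesis by simp
  qed
  have "v \<notin> e" if "e \<in> E - {{u, v}}" for e using only[of e] that by blast
  then have "simple_graph (V - {v}) (E - {{u, v}})"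
    using g by (auto simp: simple_graph_def)
  moreover have "connected_graph (V - {v}) (E - {{u, v}})"
  proof -
    \<comment> \<open>The retraction of \<open>v\<close> onto \<open>u\<close> collapses the edge
      \<open>{u, v}\<close> to a point and fixes every other edge, so it carries walks of
      \<open>E\<close> to walks that avoid \<open>v\<close>.\<close>
    define f where "f x = (if x = v then u else x)" for x
    have "(f x, f y) \<in> {(x, y). {x, y} \<in> E - {{u, v}}}\<^sup>*" if "(x, y) \<in> {(x, y). {x, y} \<in> E}\<^sup>*" for x y
      using that
    proof (induction rule: rtrancl_induct)
      case (step y z)
      then have yz: "{y, z} \<in> E" by simp
      show ?case
      proof (cases "{y, z} = {u, v}")
        case True
        then have "f y = f z" by (auto simp: f_def doubleton_eq_iff)
        with step.IH show ?thesis by simp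
      next
        case False
        with only[OF yz] have "f y = y" "f z = z" by (auto simp: f_def)
        with False yz have "(f y, f z) \<in> {(x, y). {x, y} \<in> E - {{u, v}}}" by simp
        with step.IH show ?thesis by (rule rtrancl_into_rtrancl)
      qed
    qed simp
    then have "(f x, f y) \<in> {(x, y). {x, y} \<in> E - {{u, v}}}\<^sup>*" if "x \<in> V" "y \<in> V" for x y
      using co that unfolding connected_graph_def by blast
    moreover have "f x = x" if "x \<in> V - {v}" for x using that by (simp add: f_def)
    ultimately have "(x, y) \<in> {(x, y). {x, y} \<in> E - {{u, v}}}\<^sup>*"
      if "x \<in> V - {v}" "y \<in> V - {v}" for x y using that by (metis DiffD1)
    with uV show ?thesis unfolding connected_graph_def by blast
  qed
  moreover have "\<nexists>xs. is_cycle (E - {{u, v}}) xs"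
    using acyc unfolding is_cycle_def by blast
  ultimately show "is_tree (V - {v}) (E - {{u, v}})" by (simp add: is_tree_def)
qed

lemma is_tree_no_edges:
  assumes "is_tree V {}" "r \<in> V"
  shows "V = {r}"
proof -
  have "{(x, y). {x, y} \<in> {}}\<^sup>* = Id" by simp
  then show ?thesis using assms by (auto simp: is_tree_def connected_graph_def)
qed

text \<open>Pruning a leaf lowers both numbers by one until a single node is left. The equation
  determines the length of the edge list from \<open>n\<close>.\<close>

lemma is_tree_card: "is_tree V E \<Longrightarrow> Suc (card E) = card V"
proof (induction "card E" arbitrary: V E)
  case 0
  then have "E = {}" using finite_edges[of V E] by (simp add: is_tree_def)
  moreover from 0 obtain r where "r \<in> V" by (auto simp: is_tree_def connected_graph_def)
  ultimately show ?case using is_tree_no_edges 0 by fastforce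
next
  case (Suc k)
  then have g: "simple_graph V E" "\<nexists>xs. is_cycle E xs" "E \<noteq> {}" by (auto simp: is_tree_def)
  from exists_leaf[OF this] obtain v u where vu: "neighbors E v = {u}"
    by (metis card_1_singletonE)
  note p = is_tree_prune[OF Suc.prems vu]
  have fin: "finite E" "finite V" using finite_edges[OF g(1)] g(1) by (auto simp: simple_graph_def)
  have k: "k = card (E - {{u, v}})" using Suc.hyps(2) p(4) fin by simp
  have "Suc (card (E - {{u, v}})) = card (V - {v})" by (rule Suc.hyps(1)[OF k p(1)])
  then show ?case using k Suc.hyps(2) p(3) fin by (metis card_Suc_Diff1)
qed

section \<open>Weighted sums over colorings\<close>

text \<open>With \<open>b\<close> the good neighbors of a node are those of its own color, otherwise those of the
  other color.\<close>

definition good :: "bool \<Rightarrow> 'a set set \<Rightarrow> 'a coloring \<Rightarrow> 'a \<Rightarrow> nat" where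
  "good b E c v = card {w \<in> neighbors E v. (c w = c v) = b}"

definition weight :: "bool \<Rightarrow> ('a \<Rightarrow> nat \<Rightarrow> int) \<Rightarrow> 'a set \<Rightarrow> 'a set set \<Rightarrow> int" where
  "weight b f V E = (\<Sum>c\<in>colorings V. \<Prod>v\<in>V. f v (good b E c v))"

text \<open>The degree is the number of good plus the number of bad neighbors, so \<theta> = 0 asks
  for at least as many good as bad ones and \<theta> = 1 for strictly more.\<close>

definition threshold :: "nat \<Rightarrow> 'a set set \<Rightarrow> 'a \<Rightarrow> nat \<Rightarrow> int" where
  "threshold \<theta> E v m = of_bool (card (neighbors E v) + \<theta> \<le> 2 * m)"

lemma finite_colorings: "finite V \<Longrightarrow> finite (colorings V)"
  by (simp add: colorings_def finite_PiE)

lemma sum_colorings_insert: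
  assumes "v \<notin> V"
  shows "(\<Sum>c\<in>colorings (insert v V). g c) = (\<Sum>c\<in>colorings V. g (c(v := 0)) + g (c(v := 1)))"
proof -
  have "colorings (insert v V) = (\<lambda>(y, c). c(v := y)) ` ({0, 1} \<times> colorings V)"
    by (simp add: colorings_def PiE_insert_eq)
  moreover have "inj_on (\<lambda>(y, c). c(v := y)) ({0, 1} \<times> colorings V)"
    unfolding colorings_def using inj_combinator[OF assms, of "\<lambda>_. {0, 1}"] by metis
  ultimately have "(\<Sum>c\<in>colorings (insert v V). g c)
      = (\<Sum>(y, c)\<in>{0, 1} \<times> colorings V. g (c(v := y)))"
    by (simp only: sum.reindex) (simp only: case_prod_unfold o_def)
  also have "\<dots> = (\<Sum>y\<in>{0, 1}. \<Sum>c\<in>colorings V. g (c(v := y)))"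
    by (rule sum.cartesian_product[symmetric])
  finally show ?thesis by (simp add: sum.distrib)
qed

text \<open>For a fixed coloring of the other nodes, one color of \<open>v\<close> makes the edge
  good, which gives one good neighbor to \<open>v\<close> and one more to \<open>u\<close>; the
  other color adds nothing to either. All remaining factors are common to both extensions.\<close>

lemma weight_prune:
  assumes g: "simple_graph V E" and v: "neighbors E v = {u}" and "v \<in> V" "u \<in> V" "u \<noteq> v"
  shows "weight b (f(u := \<lambda>m. f v 0 * f u m + f v 1 * f u (Suc m))) (V - {v}) (E - {{u, v}})
    = weight b f V E"
proof -
  let ?V = "V - {v}" and ?E = "E - {{u, v}}"
  let ?f = "f(u := \<lambda>m. f v 0 * f u m + f v 1 * f u (Suc m))"
  have fin: "finite V" using g by (simp add: simple_graph_def)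
  have uvE: "{u, v} \<in> E" using v by (auto simp: neighbors_def)
  have E: "E = insert {u, v} ?E" using uvE by blast
  have nb: "neighbors E x = (if x = u then insert v (neighbors ?E x)
      else if x = v then insert u (neighbors ?E x) else neighbors ?E x)" for x
    using neighbors_insert[OF \<open>u \<noteq> v\<close>, of ?E x] unfolding E[symmetric] .
  \<comment> \<open>\<open>v\<close> is isolated once the edge is gone, so its color affects no
    count with respect to \<open>?E\<close>.\<close>
  have nbu: "v \<notin> neighbors ?E x" for x
  proof
    assume "v \<in> neighbors ?E x"
    then have "x \<in> neighbors E v" "{v, x} \<noteq> {u, v}" by (auto simp: neighbors_def insert_commute)
    with v show False by (simp add: insert_commute)
  qed
  have fin': "finite (neighbors ?E x)" for x
    using finite_neighbors[OF g, of x] neighbors_mono[of ?E E x] finite_subset by blast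
  have col: "(\<Prod>x\<in>V. f x (good b E (c(v := 0)) x)) + (\<Prod>x\<in>V. f x (good b E (c(v := 1)) x))
      = (\<Prod>x\<in>?V. ?f x (good b ?E c x))" if c: "c \<in> colorings ?V" for c
  proof -
    define rest where "rest = (\<Prod>x\<in>?V - {u}. f x (good b ?E c x))"
    have cu: "c u = 0 \<or> c u = 1" using c \<open>u \<in> V\<close> \<open>u \<noteq> v\<close> by (auto simp: colorings_def)
    \<comment> \<open>The condition \<open>(y = c u) = b\<close> says that the edge is good when
      \<open>v\<close> receives the color \<open>y\<close>.\<close>
    have *: "(\<Prod>x\<in>V. f x (good b E (c(v := y)) x))
        = (if (y = c u) = b then f v 1 * f u (Suc (good b ?E c u)) else f v 0 * f u (good b ?E c u)) * rest"
      for y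
    proof -
      have "good b E (c(v := y)) v = (if (y = c u) = b then 1 else 0)"
      proof -
        have "{w \<in> neighbors E v. ((c(v := y)) w = (c(v := y)) v) = b}
            = (if (y = c u) = b then {u} else {})"
          unfolding v using \<open>u \<noteq> v\<close> by auto
        then show ?thesis by (simp add: good_def)
      qed
      moreover have "good b E (c(v := y)) u = (if (y = c u) = b then Suc (good b ?E c u) else good b ?E c u)"
      proof -
        have "{w \<in> neighbors E u. ((c(v := y)) w = (c(v := y)) u) = b}
            = (if (y = c u) = b then insert v {w \<in> neighbors ?E u. (c w = c u) = b}
               else {w \<in> neighbors ?E u. (c w = c u) = b})"
          using \<open>u \<noteq> v\<close> nbu[of u] by (auto simp: nb[of u])
        then show ?thesis using fin'[of u] nbu[of u] by (simp add: good_def)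
      qed
      moreover have "good b E (c(v := y)) x = good b ?E c x" if "x \<in> ?V - {u}" for x
        unfolding good_def
        by (rule arg_cong[where f = card]) (use that nbu[of x] in \<open>auto simp: nb[of x]\<close>)
      moreover have "(\<Prod>x\<in>V. f x (good b E (c(v := y)) x)) = f v (good b E (c(v := y)) v)
          * (f u (good b E (c(v := y)) u) * (\<Prod>x\<in>?V - {u}. f x (good b E (c(v := y)) x)))"
        using fin \<open>v \<in> V\<close> \<open>u \<in> V\<close> \<open>u \<noteq> v\<close>
        by (simp add: prod.remove[of V v] prod.remove[of ?V u])
      ultimately show ?thesis by (simp add: rest_def)
    qed
    have "(\<Prod>x\<in>?V. ?f x (good b ?E c x)) = ?f u (good b ?E c u) * rest"
    proof -
      have "(\<Prod>x\<in>?V. ?f x (good b ?E c x))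
          = ?f u (good b ?E c u) * (\<Prod>x\<in>?V - {u}. ?f x (good b ?E c x))"
        using fin \<open>u \<in> V\<close> \<open>u \<noteq> v\<close> by (simp add: prod.remove[of ?V u])
      moreover have "(\<Prod>x\<in>?V - {u}. ?f x (good b ?E c x)) = rest"
        unfolding rest_def by (rule prod.cong) auto
      ultimately show ?thesis by (simp only:)
    qed
    \<comment> \<open>Since \<open>c u\<close> is 0 or 1, exactly one of the colors 0 and 1 of
      \<open>v\<close> satisfies that condition, whichever value \<open>b\<close> has.\<close>
    then show ?thesis using cu unfolding * by (cases b) (auto simp: algebra_simps)
  qed
  have "weight b f V E = (\<Sum>c\<in>colorings (insert v ?V). \<Prod>x\<in>V. f x (good b E c x))"
    using \<open>v \<in> V\<close> by (simp add: weight_def insert_absorb)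
  also have "\<dots> = weight b ?f ?V ?E"
    unfolding weight_def by (subst sum_colorings_insert) (simp, rule sum.cong[OF refl], rule col)
  finally show ?thesis by simp
qed

lemma weight_singleton: "weight b f {r} {} = 2 * f r 0"
proof -
  have "good b {} c r = 0" for c :: "'a coloring" by (simp add: good_def neighbors_def)
  then show ?thesis
    using sum_colorings_insert[of r "{}" "\<lambda>c. \<Prod>v\<in>{r}. f v (good b {} c v)"]
    by (simp add: weight_def) (simp add: colorings_def)
qed

text \<open>A product of 0/1 indicators is 1 exactly if every node meets its condition, so the
  weight counts the colorings in \<open>X\<close>.\<close>

lemma card_satisfying:
  assumes g: "simple_graph V E" and "X \<subseteq> colorings V"
    and X: "\<And>c. c \<in> colorings V \<Longrightarrow> c \<in> X \<longleftrightarrow> (\<forall>v\<in>V. card (neighbors E v) + \<theta> \<le> 2 * good b E c v)"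
  shows "int (card X) = weight b (threshold \<theta> E) V E"
proof -
  have fin: "finite V" using g by (simp add: simple_graph_def)
  have "(\<Prod>v\<in>V. threshold \<theta> E v (good b E c v)) = of_bool (c \<in> X)" if "c \<in> colorings V" for c
    using fin X[OF that] by (auto simp: threshold_def)
  then have "weight b (threshold \<theta> E) V E = (\<Sum>c\<in>colorings V. of_bool (c \<in> X))"
    by (simp add: weight_def)
  also have "\<dots> = int (card X)"
    using finite_colorings[OF fin] \<open>X \<subseteq> colorings V\<close>
    by (simp add: Int_absorb1)
  finally show ?thesis by simp
qed

section \<open>The two processes in terms of good neighbors\<close>

lemma good_color_neighbors:
  assumes g: "simple_graph V E" and c: "c \<in> colorings V" and v: "v \<in> V"
  shows "good True E c v = card (color_neighbors E c (c v) v)"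
    "good False E c v = card (color_neighbors E c (1 - c v) v)"
    "card (neighbors E v) = good True E c v + good False E c v"
proof -
  have nV: "neighbors E v \<subseteq> V" using neighbors_subset[OF g, of v] by blast
  have c01: "c x = 0 \<or> c x = 1" if "x \<in> V" for x
    using c that by (auto simp: colorings_def)
  show "good True E c v = card (color_neighbors E c (c v) v)"
    by (simp add: good_def color_neighbors_def)
  have "{w \<in> neighbors E v. c w \<noteq> c v} = {w \<in> neighbors E v. c w = 1 - c v}"
    using c01[OF v] c01 nV by fastforce
  then show "good False E c v = card (color_neighbors E c (1 - c v) v)"
    by (simp add: good_def color_neighbors_def)
  have "neighbors E v = {w \<in> neighbors E v. c w = c v} \<union> {w \<in> neighbors E v. c w \<noteq> c v}" by blast
  then have "card (neighbors E v)
      = card ({w \<in> neighbors E v. c w = c v} \<union> {w \<in> neighbors E v. c w \<noteq> c v})" by simp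
  also have "\<dots> = good True E c v + good False E c v"
    using finite_neighbors[OF g, of v] by (subst card_Un_disjoint) (auto simp: good_def)
  finally show "card (neighbors E v) = good True E c v + good False E c v" .
qed

text \<open>A common form of both processes: \<open>b = True\<close> gives majority and
  \<open>b = False\<close> minority, as each flips a node exactly if its bad neighbors outnumber its
  good ones.\<close>

definition switch :: "bool \<Rightarrow> 'a set \<Rightarrow> 'a set set \<Rightarrow> 'a coloring \<Rightarrow> 'a coloring" where
  "switch b V E c = (\<lambda>v\<in>V. if good (\<not> b) E c v \<le> good b E c v then c v else 1 - c v)"

lemma switch_minority: "simple_graph V E \<Longrightarrow> c \<in> colorings V \<Longrightarrow> minority V E c = switch False V E c"
  unfolding minority_def switch_def by (rule restrict_ext) (simp add: good_color_neighbors)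

lemma switch_majority: "simple_graph V E \<Longrightarrow> c \<in> colorings V \<Longrightarrow> majority V E c = switch True V E c"
  unfolding majority_def switch_def by (rule restrict_ext) (simp add: good_color_neighbors)

lemma switch_colorings: "c \<in> colorings V \<Longrightarrow> switch b V E c \<in> colorings V"
  by (auto simp: colorings_def switch_def PiE_iff)

text \<open>A node keeps its color iff bad neighbors do not outnumber good ones; adding the number
  of good ones to both sides turns this into the degree bound with \<theta> = 0.\<close>

lemma card_fixed_points_switch:
  assumes g: "simple_graph V E" and M: "\<And>c. c \<in> colorings V \<Longrightarrow> F c = switch b V E c"
  shows "int (card (fixed_points V F)) = weight b (threshold 0 E) V E"
proof (rule card_satisfying[OF g])
  fix c assume c: "c \<in> colorings V"
  have c01: "1 - c v \<noteq> c v" if "v \<in> V" for v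
    using c that by (auto simp: colorings_def PiE_iff)
  have "F c = c \<longleftrightarrow> (\<forall>v\<in>V. switch b V E c v = c v)"
    using switch_colorings[OF c, of b E] c unfolding M[OF c] colorings_def by (auto intro: PiE_ext)
  also have "\<dots> \<longleftrightarrow> (\<forall>v\<in>V. good (\<not> b) E c v \<le> good b E c v)"
    using c01 by (auto simp: switch_def)
  also have "\<dots> \<longleftrightarrow> (\<forall>v\<in>V. card (neighbors E v) + 0 \<le> 2 * good b E c v)"
    by (cases b) (auto simp: good_color_neighbors(3)[OF g c])
  finally show "c \<in> fixed_points V F \<longleftrightarrow> (\<forall>v\<in>V. card (neighbors E v) + 0 \<le> 2 * good b E c v)"
    using c by (simp add: fixed_points_def)
qed (auto simp: fixed_points_def)

text \<open>The process commutes with exchanging the colors, so flipping all nodes twice always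
  returns to the start.\<close>

lemma card_pure_two_cycles_switch:
  assumes g: "simple_graph V E" and M: "\<And>c. c \<in> colorings V \<Longrightarrow> F c = switch b V E c"
  shows "int (card (pure_two_cycles V F)) = weight (\<not> b) (threshold 1 E) V E"
proof (rule card_satisfying[OF g])
  fix c assume c: "c \<in> colorings V"
  have c01: "c v = 0 \<or> c v = 1" if "v \<in> V" for v
    using c that by (auto simp: colorings_def)
  have Fc: "F c \<in> colorings V" unfolding M[OF c] by (rule switch_colorings[OF c])
  have flip_twice: "F (F c) = c" if flip: "\<forall>v\<in>V. F c v \<noteq> c v"
  proof -
    have fl: "F c v = 1 - c v" if "v \<in> V" for v
      using flip that unfolding M[OF c] by (auto simp: switch_def split: if_splits)
    have "good b' E (F c) v = good b' E c v" if "v \<in> V" for b' v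
    proof -
      have "neighbors E v \<subseteq> V" using neighbors_subset[OF g, of v] by blast
      then have "(F c w = F c v) = (c w = c v)" if "w \<in> neighbors E v" for w
        using that c01[of w] c01[OF \<open>v \<in> V\<close>] fl[of w] fl[OF \<open>v \<in> V\<close>] by auto
      then show ?thesis unfolding good_def by (intro arg_cong[where f = card]) auto
    qed
    moreover have "\<not> good (\<not> b) E c v \<le> good b E c v" if "v \<in> V" for v
      using flip that unfolding M[OF c] by (auto simp: switch_def)
    ultimately have "F (F c) v = c v" if "v \<in> V" for v
      using fl[OF that] c01[OF that] that unfolding M[OF Fc] by (auto simp: switch_def)
    then show ?thesis
      using switch_colorings[OF Fc, of b E] c unfolding M[OF Fc] colorings_def
      by (auto intro: PiE_ext)
  qed
  \<comment> \<open>A flip needs strictly more bad than good neighbors. Exchanging the roles of good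
    and bad makes this a lower bound again, whence \<open>\<not> b\<close> and \<theta> = 1.\<close>
  have "(\<forall>v\<in>V. F c v \<noteq> c v) \<longleftrightarrow> (\<forall>v\<in>V. \<not> good (\<not> b) E c v \<le> good b E c v)"
    unfolding M[OF c] using c01 by (fastforce simp: switch_def)
  also have "\<dots> \<longleftrightarrow> (\<forall>v\<in>V. card (neighbors E v) + 1 \<le> 2 * good (\<not> b) E c v)"
    by (cases b) (auto simp: good_color_neighbors(3)[OF g c])
  finally show "c \<in> pure_two_cycles V F
      \<longleftrightarrow> (\<forall>v\<in>V. card (neighbors E v) + 1 \<le> 2 * good (\<not> b) E c v)"
    using c flip_twice by (auto simp: pure_two_cycles_def)
qed (auto simp: pure_two_cycles_def)

section \<open>Weakest preconditions with time\<close>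

text \<open>The second argument of the postcondition is the time that has passed since the start
  of the whole computation; \<open>\<tau>\<close> is the time that has passed before \<open>p\<close>.\<close>

definition wp :: "com \<Rightarrow> (state \<Rightarrow> nat \<Rightarrow> bool) \<Rightarrow> state \<Rightarrow> nat \<Rightarrow> bool" where
  "wp p Q s \<tau> \<longleftrightarrow> (\<exists>t s'. exec p s t s' \<and> Q s' (\<tau> + t))"

fun writes :: "com \<Rightarrow> string set" where
  "writes Skip = {}"
| "writes (Write x i a) = {x}"
| "writes (Seq p q) = writes p \<union> writes q"
| "writes (If b p q) = writes p \<union> writes q"
| "writes (While b p) = writes p"

lemma exec_unchanged: "exec p s t s' \<Longrightarrow> x \<notin> writes p \<Longrightarrow> s' x = s x"
  by (induction rule: exec.induct) auto

lemma wp_Write: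
  "Q (s(x := (s x)(aval i s := aval a s))) (\<tau> + (1 + acost i + acost a)) \<Longrightarrow> wp (Write x i a) Q s \<tau>"
  unfolding wp_def by (blast intro: exec.Write)

lemma wp_Seq: "wp p (wp q Q) s (Suc \<tau>) \<Longrightarrow> wp (Seq p q) Q s \<tau>"
  unfolding wp_def by (force intro: exec.Seq simp: add.assoc add.commute add.left_commute)

lemma wp_If:
  assumes "bval b s \<Longrightarrow> wp p Q s (\<tau> + (1 + bcost b))" "\<not> bval b s \<Longrightarrow> wp q Q s (\<tau> + (1 + bcost b))"
  shows "wp (If b p q) Q s \<tau>"
proof (cases "bval b s")
  case True
  with assms(1) obtain t s' where "exec p s t s'" "Q s' (\<tau> + (1 + bcost b + t))"
    by (auto simp: wp_def add.assoc)
  with IfTrue[OF True] show ?thesis unfolding wp_def by blast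
next
  case False
  with assms(2) obtain t s' where "exec q s t s'" "Q s' (\<tau> + (1 + bcost b + t))"
    by (auto simp: wp_def add.assoc)
  with IfFalse[OF False] show ?thesis unfolding wp_def by blast
qed

text \<open>A bound on the time in the invariant gives termination, as every iteration takes time.\<close>

lemma wp_While:
  assumes "I s \<tau>" and bound: "\<And>s \<tau>. I s \<tau> \<Longrightarrow> \<tau> \<le> B"
    and step: "\<And>s \<tau>. I s \<tau> \<Longrightarrow> bval b s \<Longrightarrow> wp p I s (\<tau> + (1 + bcost b))"
    and exit: "\<And>s \<tau>. I s \<tau> \<Longrightarrow> \<not> bval b s \<Longrightarrow> Q s (\<tau> + (1 + bcost b))"
  shows "wp (While b p) Q s \<tau>"
  using assms(1)
proof (induction "B - \<tau>" arbitrary: s \<tau> rule: less_induct)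
  case less
  show ?case
  proof (cases "bval b s")
    case True
    with step[OF less.prems] obtain t s' where p: "exec p s t s'" "I s' (\<tau> + (1 + bcost b + t))"
      by (auto simp: wp_def add.assoc)
    have "B - (\<tau> + (1 + bcost b + t)) < B - \<tau>" using bound[OF p(2)] by simp
    from less.hyps[OF this p(2)] obtain t' s''
      where "exec (While b p) s' t' s''" "Q s'' (\<tau> + (1 + bcost b + t + t'))"
      by (auto simp: wp_def add.assoc)
    with WhileTrue[OF True p(1)] show ?thesis unfolding wp_def by blast
  next
    case False
    with WhileFalse[OF False, of p] exit[OF less.prems] show ?thesis unfolding wp_def by blast
  qed
qed

lemma wp_frame:
  assumes "wp p Q s \<tau>"
    and "\<And>s' \<tau>'. Q s' \<tau>' \<Longrightarrow> (\<And>x. x \<notin> writes p \<Longrightarrow> s' x = s x) \<Longrightarrow> Q' s' \<tau>'"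
  shows "wp p Q' s \<tau>"
  using assms exec_unchanged unfolding wp_def by metis

section \<open>Scalar variables and counting loops\<close>

abbreviation var :: "string \<Rightarrow> aexp" where
  "var x \<equiv> Read x (Const 0)"

abbreviation assign :: "string \<Rightarrow> aexp \<Rightarrow> com" where
  "assign x a \<equiv> Write x (Const 0) a"

definition For :: "string \<Rightarrow> aexp \<Rightarrow> com \<Rightarrow> com" where
  "For x e p = Seq (assign x (Const 0))
     (While (Less (var x) e) (Seq p (assign x (Plus (var x) (Const 1)))))"

lemma writes_For [simp]: "writes (For x e p) = insert x (writes p)"
  by (auto simp: For_def)

text \<open>The bound \<open>e\<close> is evaluated anew before every iteration, so its value must
  survive changes of the counter and of the arrays that the body writes. \<open>J\<close> gets the
  number of iterations as an argument and must ignore \<open>x\<close>, which the loop itself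
  increments.\<close>

lemma wp_For:
  fixes N T :: nat
  assumes x: "x \<notin> writes p"
    and indep: "\<And>k s f. J k s \<Longrightarrow> J k (s(x := f))"
    and e: "\<And>s'. (\<And>y. y \<notin> insert x (writes p) \<Longrightarrow> s' y = s y) \<Longrightarrow> aval e s' = int N"
    and J0: "J 0 s"
    and body: "\<And>k s' \<tau>. k < N \<Longrightarrow> J k s' \<Longrightarrow> s' x 0 = int k \<Longrightarrow>
      (\<And>y. y \<notin> insert x (writes p) \<Longrightarrow> s' y = s y) \<Longrightarrow>
      wp p (\<lambda>s' \<tau>'. J (Suc k) s' \<and> \<tau>' \<le> \<tau> + T) s' \<tau>"
    and Q: "\<And>s' \<tau>'. J N s' \<Longrightarrow> (\<And>y. y \<notin> insert x (writes p) \<Longrightarrow> s' y = s y) \<Longrightarrow>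
      \<tau>' \<le> \<tau> + Suc N * (T + acost e + 15) \<Longrightarrow> Q s' \<tau>'"
  shows "wp (For x e p) Q s \<tau>"
proof -
  define c where "c = T + acost e + 15"
  \<comment> \<open>Elapsed time, plus \<open>c\<close> for each remaining iteration, plus
    \<open>acost e + 4\<close> for the final failing test, stays within the budget. The extra
    \<open>c\<close> in \<open>Suc N * c\<close> pays for the initial assignment and that
    test.\<close>
  define I where "I s' \<tau>' \<longleftrightarrow> (\<exists>k\<le>N. s' x 0 = int k \<and> J k s' \<and>
    (\<forall>y. y \<notin> insert x (writes p) \<longrightarrow> s' y = s y) \<and> \<tau>' + (N - k) * c + acost e + 4 \<le> \<tau> + Suc N * c)"
    for s' \<tau>'
  show ?thesis unfolding For_def
  proof (rule wp_Seq, rule wp_Write, rule wp_While[where I = I and B = "\<tau> + Suc N * c"])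
    show "I (s(x := (s x)(aval (Const 0) s := aval (Const 0) s)))
        (Suc \<tau> + (1 + acost (Const 0) + acost (Const 0)))"
      unfolding I_def using indep[OF J0] by (intro exI[of _ 0]) (auto simp: c_def)
  next
    show "\<tau>' \<le> \<tau> + Suc N * c" if "I s' \<tau>'" for s' \<tau>'
      using that by (auto simp: I_def)
  next
    fix s' \<tau>' assume "I s' \<tau>'" and b: "bval (Less (var x) e) s'"
    then obtain k where k: "k \<le> N" "s' x 0 = int k" "J k s'"
      and fr: "\<And>y. y \<notin> insert x (writes p) \<Longrightarrow> s' y = s y"
      and \<tau>': "\<tau>' + (N - k) * c + acost e + 4 \<le> \<tau> + Suc N * c"
      unfolding I_def by blast
    have kN: "k < N" using b e[OF fr] k(2) by simp
    then obtain d where d: "N - k = Suc d" "N - Suc k = d" by (metis Suc_diff_Suc)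
    show "wp (Seq p (assign x (Plus (var x) (Const 1)))) I s' (\<tau>' + (1 + bcost (Less (var x) e)))"
    proof (rule wp_Seq, rule wp_frame[OF body[OF kN k(3,2) fr]])
      fix s'' \<tau>''
      assume J: "J (Suc k) s'' \<and> \<tau>'' \<le> Suc (\<tau>' + (1 + bcost (Less (var x) e))) + T"
        and fr': "\<And>y. y \<notin> writes p \<Longrightarrow> s'' y = s' y"
      have time: "\<tau>'' + 6 + d * c + acost e + 4 \<le> \<tau> + Suc N * c"
        using J \<tau>' unfolding d by (simp add: c_def)
      show "wp (assign x (Plus (var x) (Const 1))) I s'' \<tau>''"
      proof (rule wp_Write, unfold I_def, intro exI[of _ "Suc k"] conjI allI impI)
        show "Suc k \<le> N" using kN by simp
      qed (use J indep fr fr' x k(2) time d in \<open>auto simp: algebra_simps\<close>)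
    qed auto
  next
    fix s' \<tau>' assume "I s' \<tau>'" and b: "\<not> bval (Less (var x) e) s'"
    then obtain k where k: "k \<le> N" "s' x 0 = int k" "J k s'"
      and fr: "\<And>y. y \<notin> insert x (writes p) \<Longrightarrow> s' y = s y"
      and \<tau>': "\<tau>' + (N - k) * c + acost e + 4 \<le> \<tau> + Suc N * c"
      unfolding I_def by blast
    have "k = N" using b e[OF fr] k by simp
    with k fr \<tau>' show "Q s' (\<tau>' + (1 + bcost (Less (var x) e)))"
      by (intro Q) (auto simp: c_def)
  qed
qed

section \<open>The program\<close>

text \<open>\<open>D\<close> holds the current degrees, \<open>X\<close> the sums of the current neighbors, and
  \<open>P\<close> holds \<open>f v m\<close> at index \<open>v * n + m\<close>; \<open>r\<close> is a node that has not been removed. The first run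
  leaves its data behind, which \<open>clear\<close> removes for the second run.\<close>

definition clear :: com where
  "clear = For ''i'' (var ''nodes'')
     (Seq (Write ''D'' (var ''i'') (Const 0)) (Write ''X'' (var ''i'') (Const 0)))"

text \<open>A tree has \<open>n - 1\<close> edges, so the input need not contain their
  number.\<close>

definition load :: com where
  "load = For ''i'' (Minus (var ''nodes'') (Const 1))
     (Seq (assign ''u'' (Read ''source'' (var ''i'')))
     (Seq (assign ''v'' (Read ''target'' (var ''i'')))
     (Seq (Write ''D'' (var ''u'') (Plus (Read ''D'' (var ''u'')) (Const 1)))
     (Seq (Write ''D'' (var ''v'') (Plus (Read ''D'' (var ''v'')) (Const 1)))
     (Seq (Write ''X'' (var ''u'') (Plus (Read ''X'' (var ''u'')) (var ''v'')))
          (Write ''X'' (var ''v'') (Plus (Read ''X'' (var ''v'')) (var ''u''))))))))"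

abbreviation entry :: "string \<Rightarrow> aexp \<Rightarrow> aexp" where
  "entry x a \<equiv> Plus (Times (var x) (var ''nodes'')) a"

text \<open>A count of good neighbors never exceeds the degree, so each row is filled only that far;
  this keeps the time within O(n\<Delta>).\<close>

definition weights :: "int \<Rightarrow> com" where
  "weights \<theta> = For ''v'' (var ''nodes'') (For ''m'' (Plus (Read ''D'' (var ''v'')) (Const 1))
     (If (Less (Plus (var ''m'') (var ''m'')) (Plus (Read ''D'' (var ''v'')) (Const \<theta>)))
        (Write ''P'' (entry ''v'' (var ''m'')) (Const 0))
        (Write ''P'' (entry ''v'' (var ''m'')) (Const 1))))"

definition update :: com where
  "update = For ''m'' (Plus (Read ''D'' (var ''u'')) (Const 1))
     (Write ''P'' (entry ''u'' (var ''m''))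
        (Plus (Times (var ''a'') (Read ''P'' (entry ''u'' (var ''m''))))
              (Times (var ''b'') (Read ''P'' (entry ''u'' (Plus (var ''m'') (Const 1)))))))"

text \<open>\<open>D\<close> is lowered at \<open>u\<close> before \<open>update\<close>, so the
  loop there ends at the new degree and reads no further than the entry for the old one. At the end
  \<open>u\<close> becomes the known survivor and the next candidate for removal.\<close>

definition prune :: com where
  "prune =
     Seq (assign ''u'' (Read ''X'' (var ''v'')))
    (Seq (Write ''D'' (var ''v'') (Const 0))
    (Seq (Write ''X'' (var ''v'') (Const 0))
    (Seq (Write ''D'' (var ''u'') (Minus (Read ''D'' (var ''u'')) (Const 1)))
    (Seq (Write ''X'' (var ''u'') (Minus (Read ''X'' (var ''u'')) (var ''v'')))
    (Seq (assign ''a'' (Read ''P'' (entry ''v'' (Const 0))))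
    (Seq (assign ''b'' (Read ''P'' (entry ''v'' (Const 1))))
    (Seq update
    (Seq (assign ''r'' (var ''u''))
         (assign ''v'' (var ''u''))))))))))"

definition prune_all :: com where
  "prune_all =
     Seq (assign ''i'' (Const 0)) (Seq (assign ''v'' (Const 0)) (Seq (assign ''r'' (Const 0))
       (While (Less (var ''v'') (var ''nodes''))
         (If (And (Less (Const 0) (Read ''D'' (var ''v''))) (Less (Read ''D'' (var ''v'')) (Const 2)))
            prune
            (Seq (assign ''i'' (Plus (var ''i'') (Const 1))) (assign ''v'' (var ''i'')))))))"

definition count :: "int \<Rightarrow> string \<Rightarrow> com" where
  "count \<theta> x = Seq clear (Seq load (Seq (weights \<theta>) (Seq prune_all
     (assign x (Times (Const 2) (Read ''P'' (entry ''r'' (Const 0))))))))"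

definition adjacency :: "nat \<Rightarrow> state \<Rightarrow> nat set set \<Rightarrow> bool" where
  "adjacency n s E \<longleftrightarrow> (\<forall>x<n. s ''D'' (int x) = int (card (neighbors E x)) \<and>
     s ''X'' (int x) = int (\<Sum>(neighbors E x)))"

text \<open>Restricting \<open>m\<close> to the current degree permits stale entries behind it, such
  as the last one of the row of \<open>u\<close> after a pruning.\<close>

definition table :: "nat \<Rightarrow> state \<Rightarrow> nat set \<Rightarrow> nat set set \<Rightarrow> (nat \<Rightarrow> nat \<Rightarrow> int) \<Rightarrow> bool" where
  "table n s R E f \<longleftrightarrow>
     (\<forall>v\<in>R. \<forall>m\<le>card (neighbors E v). s ''P'' (int v * int n + int m) = f v m)"

section \<open>Correctness and running time\<close>

lemma wp_clear:
  assumes n: "s ''nodes'' 0 = int n"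
    and Q: "\<And>s' \<tau>'. adjacency n s' {} \<Longrightarrow> (\<And>y. y \<notin> {''i'', ''D'', ''X''} \<Longrightarrow> s' y = s y) \<Longrightarrow>
      \<tau>' \<le> \<tau> + Suc n * 26 \<Longrightarrow> Q s' \<tau>'"
  shows "wp clear Q s \<tau>"
  unfolding clear_def
proof (rule wp_For[where N = n and T = 9 and
      J = "\<lambda>k s. \<forall>x<k. s ''D'' (int x) = 0 \<and> s ''X'' (int x) = 0"], goal_cases)
  case 5
  then show ?case by (intro wp_Seq wp_Write) (auto simp: less_Suc_eq)
next
  case 6
  then show ?case by (intro Q) (auto simp: adjacency_def neighbors_def)
qed (use n in auto)

section \<open>Degrees and neighbor sums when edges come and go\<close>

lemma adjacency_insert:
  assumes adj: "adjacency n s F" and g: "simple_graph {..<n} F"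
    and "a < n" "b < n" "a \<noteq> b" "{a, b} \<notin> F"
    and D: "s' ''D'' = (s ''D'')(int a := s ''D'' (int a) + 1, int b := s ''D'' (int b) + 1)"
    and X: "s' ''X'' = (s ''X'')(int a := s ''X'' (int a) + int b, int b := s ''X'' (int b) + int a)"
  shows "adjacency n s' (insert {a, b} F)"
  unfolding adjacency_def
proof (intro allI impI)
  fix x assume "x < n"
  with adj assms(3-6) show "s' ''D'' (int x) = int (card (neighbors (insert {a, b} F) x)) \<and>
    s' ''X'' (int x) = int (\<Sum>(neighbors (insert {a, b} F) x))"
    by (simp add: neighbors_insert D X adjacency_def finite_neighbors[OF g] not_mem_neighbors)
qed

lemma adjacency_remove:
  assumes adj: "adjacency n s F" and g: "simple_graph {..<n} F"
    and "u < n" "v < n" "u \<noteq> v" and nb: "neighbors F v = {u}"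
    and D: "s' ''D'' = (s ''D'')(int v := 0, int u := s ''D'' (int u) - 1)"
    and X: "s' ''X'' = (s ''X'')(int v := 0, int u := s ''X'' (int u) - int v)"
  shows "adjacency n s' (F - {{u, v}})"
  unfolding adjacency_def
proof (intro allI impI)
  fix x assume "x < n"
  let ?F = "F - {{u, v}}"
  have uv: "{u, v} \<in> F" using nb by (auto simp: neighbors_def)
  then have F: "F = insert {u, v} ?F" by blast
  have g': "simple_graph {..<n} ?F" using g by (auto simp: simple_graph_def)
  have not: "u \<notin> neighbors ?F v" "v \<notin> neighbors ?F u" by (auto simp: neighbors_def insert_commute)
  have nbF: "neighbors F x = (if x = u then insert v (neighbors ?F x)
      else if x = v then insert u (neighbors ?F x) else neighbors ?F x)" for x
    using neighbors_insert[OF \<open>u \<noteq> v\<close>, of ?F x] unfolding F[symmetric] .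
  have "neighbors ?F v = {}" using nbF[of v] nb not \<open>u \<noteq> v\<close> by auto
  then show "s' ''D'' (int x) = int (card (neighbors ?F x)) \<and> s' ''X'' (int x) = int (\<Sum>(neighbors ?F x))"
    using adj \<open>x < n\<close> \<open>u \<noteq> v\<close> not nbF[of x]
    by (auto simp: D X adjacency_def finite_neighbors[OF g'])
qed

lemma wp_load:
  assumes n: "s ''nodes'' 0 = int n" and t: "is_tree {..<n} E" and es: "edge_list E es"
    and src: "s ''source'' = array_of (map fst es)" and tgt: "s ''target'' = array_of (map snd es)"
    and adj: "adjacency n s {}"
    and Q: "\<And>s' \<tau>'. adjacency n s' E \<Longrightarrow> (\<And>y. y \<notin> {''i'', ''u'', ''v'', ''D'', ''X''} \<Longrightarrow> s' y = s y) \<Longrightarrow>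
      \<tau>' \<le> \<tau> + n * 70 \<Longrightarrow> Q s' \<tau>'"
  shows "wp load Q s \<tau>"
proof -
  let ?e = "\<lambda>(u, v). {u, v}"
  have g: "simple_graph {..<n} E" using t by (simp add: is_tree_def)
  have dist: "distinct (map ?e es)" and E: "set (map ?e es) = E"
    using es by (auto simp: edge_list_def)
  have "length es = card E" using distinct_card[OF dist] E by simp
  with is_tree_card[OF t] have len: "Suc (length es) = n" by simp
  show ?thesis unfolding load_def
  proof (rule wp_For[where N = "length es" and T = 50 and
        J = "\<lambda>k s. adjacency n s (set (map ?e (take k es)))"], goal_cases)
    case (5 k s' \<tau>)
    let ?F = "set (map ?e (take k es))"
    obtain a b where ab: "es ! k = (a, b)" by force
    have "?e (es ! k) \<in> set (map ?e es)" using nth_mem[OF 5(1)] by (simp only: set_map imageI)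
    then have "{a, b} \<in> E" unfolding E ab by simp
    then have "{a, b} \<subseteq> {..<n}" "card {a, b} = 2" using g unfolding simple_graph_def by blast+
    then have lt: "a < n" "b < n" and ne: "a \<noteq> b" by (simp, simp, cases "a = b") auto
    have F: "?F \<subseteq> E" using E set_take_subset[of k "map ?e es"] by (simp add: take_map)
    \<comment> \<open>The list is distinct as a list of unordered pairs, so the next edge raises
      both degrees by exactly one.\<close>
    have new: "{a, b} \<notin> ?F"
    proof -
      have "distinct (take (Suc k) (map ?e es))" using dist by (rule distinct_take)
      then show ?thesis using 5(1) ab by (simp add: take_Suc_conv_app_nth take_map)
    qed
    have gF: "simple_graph {..<n} ?F" using g F unfolding simple_graph_def by blast
    have Suc: "set (map ?e (take (Suc k) es)) = insert {a, b} ?F"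
      using 5(1) ab by (simp add: take_Suc_conv_app_nth)
    have rd: "s' ''source'' (int k) = int a" "s' ''target'' (int k) = int b"
      using 5(4)[of "''source''"] 5(4)[of "''target''"] 5(1) ab by (simp_all add: src tgt array_of_def)
    show ?case unfolding Suc
      by (intro wp_Seq wp_Write conjI adjacency_insert[OF 5(2) gF lt ne new])
        (use ne 5(3) rd in \<open>simp_all\<close>)
  next
    case (6 s' \<tau>')
    \<comment> \<open>The cost per iteration is 69 = 50 + 4 + 15: the body, the bound
      \<open>n - 1\<close>, and the overhead of the loop.\<close>
    have "Suc (length es) * 69 \<le> n * 70" using len by simp
    with 6 show ?case by (intro Q) (auto simp: E[simplified])
  qed (use n len adj in \<open>auto simp: adjacency_def\<close>)
qed

text \<open>Quotient and remainder modulo \<open>n\<close> are unique, so the rows of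
  \<open>P\<close> do not overlap as long as all column indices are below \<open>n\<close>.\<close>

lemma index_inj:
  assumes "m < n" "k < n" and "int a * int n + int m = int b * int n + int k"
  shows "a = b" "m = k"
proof -
  from assms(3) have eq: "a * n + m = b * n + k" by (metis of_nat_add of_nat_mult of_nat_eq_iff)
  have "(a * n + m) div n = a" "(b * n + k) div n = b" using assms by simp_all
  then show "a = b" using eq by simp
  with eq show "m = k" by simp
qed

lemma wp_weights:
  assumes n: "s ''nodes'' 0 = int n" and adj: "adjacency n s E"
    and deg: "\<And>v. v < n \<Longrightarrow> card (neighbors E v) < n" "\<And>v. v < n \<Longrightarrow> card (neighbors E v) \<le> K"
    and Q: "\<And>s' \<tau>'. table n s' {..<n} E (threshold \<theta> E) \<Longrightarrow>
      (\<And>y. y \<notin> {''v'', ''m'', ''P''} \<Longrightarrow> s' y = s y) \<Longrightarrow>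
      \<tau>' \<le> \<tau> + Suc n * (42 * K + 101) \<Longrightarrow> Q s' \<tau>'"
  shows "wp (weights (int \<theta>)) Q s \<tau>"
  unfolding weights_def
\<comment> \<open>The inner loop costs 42 = 22 + 5 + 15 per round, with at most \<open>K + 2\<close>
  rounds charged; the outer loop adds 2 + 15.\<close>
proof (rule wp_For[where N = n and T = "(K + 2) * 42" and
      J = "\<lambda>k s. table n s {..<k} E (threshold \<theta> E)"], goal_cases)
  case (5 k s' \<tau>)
  let ?d = "card (neighbors E k)"
  have n': "s' ''nodes'' 0 = int n" and D: "s' ''D'' = s ''D''" using 5(4) n by auto
  have Dk: "s ''D'' (int k) = int ?d" using adj 5(1) by (simp add: adjacency_def)
  show ?case
  proof (rule wp_For[where N = "Suc ?d" and T = 22 and J = "\<lambda>m s. table n s {..<k} E (threshold \<theta> E) \<and>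
          (\<forall>j<m. s ''P'' (int k * int n + int j) = threshold \<theta> E k j)"], goal_cases)
    case (5 m s'' \<tau>)
    have rd: "s'' ''v'' 0 = int k" "s'' ''nodes'' 0 = int n" "s'' ''D'' (int k) = int ?d"
      using 5(4) n' D Dk \<open>s' ''v'' 0 = int k\<close> by simp_all
    have mn: "m < n" using 5(1) deg(1)[OF \<open>k < n\<close>] by simp
    have inj: "int x * int n + int j = int k * int n + int m \<longleftrightarrow> x = k \<and> j = m"
      if "j < n" for x j using index_inj[OF that mn] by blast
    have val: "threshold \<theta> E k m = (if int m + int m < int ?d + int \<theta> then 0 else 1)"
      by (auto simp: threshold_def)
    have step: "table n t {..<k} E (threshold \<theta> E) \<and>
        (\<forall>j<Suc m. t ''P'' (int k * int n + int j) = threshold \<theta> E k j)"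
      if t: "t ''P'' = (s'' ''P'')(int k * int n + int m := threshold \<theta> E k m)" for t
    proof (intro conjI allI impI)
      show "table n t {..<k} E (threshold \<theta> E)"
        unfolding table_def
      proof (intro ballI allI impI)
        fix x j assume x: "x \<in> {..<k}" "j \<le> card (neighbors E x)"
        then have "x \<noteq> k" "j < n" using deg(1)[of x] \<open>k < n\<close> by simp_all
        then show "t ''P'' (int x * int n + int j) = threshold \<theta> E x j"
          using x 5(2) by (simp add: t inj table_def)
      qed
      fix j assume "j < Suc m"
      then show "t ''P'' (int k * int n + int j) = threshold \<theta> E k j"
        using 5(2) mn by (auto simp: t inj less_Suc_eq)
    qed
    show ?case
      by (rule wp_If; rule wp_Write; rule conjI[OF step]; insert 5(3) rd val; simp)
  next
    case (6 s'' \<tau>')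
    have "Suc (Suc ?d) * 42 \<le> (K + 2) * 42" using deg(2)[OF \<open>k < n\<close>] by simp
    moreover have "table n s'' {..<Suc k} E (threshold \<theta> E)"
      using 6(1) unfolding table_def lessThan_Suc by (simp only: ball_simps less_Suc_eq_le conj_commute)
    ultimately show ?case using 6(3) by simp
  qed (use 5 D Dk in \<open>auto simp: table_def\<close>)
next
  case (6 s' \<tau>')
  then show ?case by (intro Q) (auto simp: algebra_simps)
qed (use n in \<open>auto simp: table_def\<close>)

text \<open>Because \<open>m\<close> ascends, the entry at \<open>j + 1\<close> is still the old one
  when \<open>j\<close> is overwritten. The in-place update can thus be stated in terms of the
  initial contents of \<open>P\<close>.\<close>

lemma wp_update:
  assumes "s ''nodes'' 0 = int n" "s ''u'' 0 = int u" "s ''D'' (int u) = int d"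
    and Q: "\<And>s' \<tau>'. s' ''P'' = (\<lambda>j. if int u * int n \<le> j \<and> j \<le> int u * int n + int d
        then s ''a'' 0 * s ''P'' j + s ''b'' 0 * s ''P'' (j + 1) else s ''P'' j) \<Longrightarrow>
      (\<And>y. y \<notin> {''m'', ''P''} \<Longrightarrow> s' y = s y) \<Longrightarrow> \<tau>' \<le> \<tau> + (d + 2) * 56 \<Longrightarrow> Q s' \<tau>'"
  shows "wp update Q s \<tau>"
  unfolding update_def
proof (rule wp_For[where N = "Suc d" and T = 36 and
      J = "\<lambda>k s'. s' ''P'' = (\<lambda>j. if int u * int n \<le> j \<and> j < int u * int n + int k
        then s ''a'' 0 * s ''P'' j + s ''b'' 0 * s ''P'' (j + 1) else s ''P'' j)"], goal_cases)
  case (5 k s' \<tau>)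
  show ?case by (rule wp_Write) (use 5 assms in \<open>auto simp: fun_eq_iff add.assoc\<close>)
next
  case (6 s' \<tau>')
  then show ?case by (intro Q) (auto simp: fun_eq_iff)
qed (use assms in auto)

lemma wp_prune:
  assumes n: "s ''nodes'' 0 = int n" and t: "is_tree R F" and R: "R \<subseteq> {..<n}"
    and adj: "adjacency n s F" and tab: "table n s R F f"
    and v: "s ''v'' 0 = int v" and nb: "neighbors F v = {u}"
    and deg: "\<And>x. x < n \<Longrightarrow> card (neighbors F x) < n" "\<And>x. x < n \<Longrightarrow> card (neighbors F x) \<le> K"
    and "1 \<le> K"
    and Q: "\<And>s' \<tau>'. adjacency n s' (F - {{u, v}}) \<Longrightarrow>
      table n s' (R - {v}) (F - {{u, v}}) (f(u := \<lambda>m. f v 0 * f u m + f v 1 * f u (Suc m))) \<Longrightarrow>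
      s' ''v'' 0 = int u \<Longrightarrow> s' ''r'' 0 = int u \<Longrightarrow>
      (\<And>y. y \<in> {''nodes'', ''i''} \<Longrightarrow> s' y = s y) \<Longrightarrow> \<tau>' \<le> \<tau> + 240 * K \<Longrightarrow> Q s' \<tau>'"
  shows "wp prune Q s \<tau>"
proof -
  let ?F = "F - {{u, v}}" and ?f = "f(u := \<lambda>m. f v 0 * f u m + f v 1 * f u (Suc m))"
  have gR: "simple_graph R F" using t by (simp add: is_tree_def)
  then have g: "simple_graph {..<n} F" using R unfolding simple_graph_def by blast
  have uR: "u \<in> R" and vR: "v \<in> R" and uv: "u \<noteq> v" using is_tree_prune[OF t nb] by auto
  then have lt: "u < n" "v < n" using R by auto
  have vF: "v \<in> neighbors F u" using nb by (auto simp: neighbors_def insert_commute)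
  have nbu: "neighbors ?F u = neighbors F u - {v}"
    using uv by (auto simp: neighbors_def doubleton_eq_iff)
  have nbx: "neighbors ?F x \<subseteq> neighbors F x" for x by (rule neighbors_mono) blast
  define d where "d = card (neighbors ?F u)"
  have d: "card (neighbors F u) = Suc d"
    unfolding d_def nbu using vF finite_neighbors[OF g, of u] by (metis card_Suc_Diff1)
  have dn: "Suc d < n" "Suc d \<le> K" using deg[OF lt(1)] d by simp_all
  define A where "A = s ''P'' (int v * int n)"
  define B where "B = s ''P'' (int v * int n + 1)"
  have "card (neighbors F v) = 1" by (simp add: nb)
  \<comment> \<open>A leaf has degree 1, so the table guarantees precisely the two entries of its
    row that are read.\<close>
  then have tv: "\<And>m. m \<le> 1 \<Longrightarrow> s ''P'' (int v * int n + int m) = f v m"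
    using tab vR unfolding table_def by metis
  have AB: "A = f v 0" "B = f v 1" using tv[of 0] tv[of 1] by (simp_all add: A_def B_def)
  have Xv: "s ''X'' (int v) = int u" and Du: "s ''D'' (int u) = 1 + int d"
    using adj lt nb d by (simp_all add: adjacency_def)
  have tab': "table n s' (R - {v}) ?F ?f"
    if P: "s' ''P'' = (\<lambda>j. if int u * int n \<le> j \<and> j \<le> int u * int n + int d
      then A * s ''P'' j + B * s ''P'' (j + 1) else s ''P'' j)" for s'
    unfolding table_def
  proof (intro ballI allI impI)
    fix x m assume x: "x \<in> R - {v}" and m: "m \<le> card (neighbors ?F x)"
    have mF: "m \<le> card (neighbors F x)"
      using m card_mono[OF finite_neighbors[OF g] nbx[of x]] by simp
    have mn: "m < n" using mF deg(1)[of x] x R by auto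
    show "s' ''P'' (int x * int n + int m) = ?f x m"
    proof (cases "x = u")
      case True
      have md: "m \<le> d" using m True d_def by simp
      have tu: "s ''P'' (int u * int n + int j) = f u j" if "j \<le> Suc d" for j
        using tab uR that d by (simp add: table_def)
      show ?thesis using md tu[of m] tu[of "Suc m"] by (simp add: P True AB add.assoc add.commute)
    next
      case False
      \<comment> \<open>The overwritten interval lies inside row \<open>u\<close> because
        \<open>d < n\<close>, so it misses the entries of every other row.\<close>
      have "\<not> (int u * int n \<le> int x * int n + int m \<and> int x * int n + int m \<le> int u * int n + int d)"
      proof
        assume a: "int u * int n \<le> int x * int n + int m \<and> int x * int n + int m \<le> int u * int n + int d"
        define k where "k = nat (int x * int n + int m - int u * int n)"
        have k: "int x * int n + int m = int u * int n + int k" "k \<le> d" using a by (simp_all add: k_def nat_le_iff)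
        have "k < n" using k(2) dn by simp
        from index_inj(1)[OF mn this k(1)] False show False by simp
      qed
      then have "s' ''P'' (int x * int n + int m) = s ''P'' (int x * int n + int m)"
        unfolding P by (simp only: if_False)
      also have "\<dots> = f x m" using tab x mF by (simp add: table_def)
      finally show ?thesis using False by simp
    qed
  qed
  show ?thesis unfolding prune_def
    apply (rule wp_Seq, rule wp_Write, simp add: v Xv)
    apply (rule wp_Seq, rule wp_Write, simp add: v)
    apply (rule wp_Seq, rule wp_Write, simp add: v)
    apply (rule wp_Seq, rule wp_Write, simp add: v uv Du)
    apply (rule wp_Seq, rule wp_Write, simp add: v uv)
    apply (rule wp_Seq, rule wp_Write, simp add: v n flip: A_def)
    apply (rule wp_Seq, rule wp_Write, simp add: v n flip: B_def)
    apply (rule wp_Seq, rule wp_update[where n = n and u = u and d = d])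
    subgoal by (simp add: n)
    subgoal by simp
    subgoal by simp
    subgoal for s' \<tau>'
      apply (rule wp_Seq, rule wp_Write, simp)
      apply (rule wp_Write, simp)
      apply (rule Q)
      subgoal
        by (rule adjacency_remove[OF adj g lt uv nb]) (simp_all add: Du)
      subgoal by (rule tab') (simp cong: if_cong)
      subgoal by simp
      subgoal by simp
      subgoal premises p for y using p(4) p(2)[of y] by (elim insertE emptyE) simp_all
      subgoal using dn(2) \<open>1 \<le> K\<close> by simp
      done
    done
qed

lemma wp_prune_all:
  assumes n: "s ''nodes'' 0 = int n" and t: "is_tree {..<n} E"
    and adj: "adjacency n s E" and tab: "table n s {..<n} E f"
    and deg: "\<And>x. x < n \<Longrightarrow> card (neighbors E x) \<le> K" and K: "1 \<le> K"
    and Q: "\<And>s' \<tau>'. (\<And>b. weight b f {..<n} E = 2 * s' ''P'' (s' ''r'' 0 * int n)) \<Longrightarrow>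
      s' ''nodes'' 0 = int n \<Longrightarrow> \<tau>' \<le> \<tau> + 320 * (n * K) \<Longrightarrow> Q s' \<tau>'"
  shows "wp prune_all Q s \<tau>"
proof -
  have gE: "simple_graph {..<n} E" using t by (simp add: is_tree_def)
  have card: "Suc (card E) = n" using is_tree_card[OF t] by simp
  have degn: "card (neighbors E x) < n" if "x < n" for x
    using card_mono[OF _ neighbors_subset[OF gE, of x]] that by simp
  \<comment> \<open>Each of the at most \<open>n\<close> scan steps costs at most
    \<open>30 * K\<close>, and each of the \<open>card E\<close> prunings at most
    \<open>260 * K\<close>, loop test and branching included.\<close>
  define B where "B = \<tau> + 20 + n * (30 * K) + card E * (260 * K)"
  \<comment> \<open>The remaining tree \<open>R\<close>, \<open>F\<close> with functions
    \<open>g\<close> has the original weight. Each of its leaves is either ahead of the scan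
    position \<open>i\<close> or the current node \<open>v\<close>. The indices \<open>i\<close> and
    \<open>v\<close> reach \<open>n\<close> only together, so testing \<open>v\<close> detects the
    end of the scan.\<close>
  define G where "G s' \<tau>' R F g i v r \<longleftrightarrow> is_tree R F \<and> R \<subseteq> {..<n} \<and> F \<subseteq> E \<and>
    adjacency n s' F \<and> table n s' R F g \<and> s' ''i'' 0 = int i \<and> s' ''v'' 0 = int v \<and>
    s' ''r'' 0 = int r \<and> s' ''nodes'' 0 = int n \<and> r \<in> R \<and> (i < n \<and> v < n \<or> i = n \<and> v = n) \<and>
    (\<forall>x. card (neighbors F x) = 1 \<longrightarrow> i < x \<or> x = v) \<and>
    (\<forall>b. weight b g R F = weight b f {..<n} E) \<and>
    \<tau>' + (n - i) * (30 * K) + card F * (260 * K) \<le> B"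
    for s' \<tau>' R F g i v r
  define I where "I s' \<tau>' \<longleftrightarrow> (\<exists>R F g i v r. G s' \<tau>' R F g i v r)" for s' \<tau>'
  have IG: "G s' \<tau>' R F g i v r \<Longrightarrow> I s' \<tau>'" for s' \<tau>' R F g i v r
    unfolding I_def by blast
  show ?thesis unfolding prune_all_def
  proof (intro wp_Seq wp_Write, rule wp_While[where I = I and B = B], goal_cases)
    case 1
    have "G (s(''i'' := (s ''i'')(0 := 0), ''v'' := (s ''v'')(0 := 0), ''r'' := (s ''r'')(0 := 0)))
        (\<tau> + 12) {..<n} E f 0 0 0"
      using t n adj tab card by (auto simp: G_def B_def adjacency_def table_def)
    from IG[OF this] show ?case by (simp add: numeral_eq_Suc)
  next
    case (2 s' \<tau>')
    then show ?case by (auto simp: I_def G_def)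
  next
    case (3 s' \<tau>')
    then obtain R F g i v r where G: "G s' \<tau>' R F g i v r" by (auto simp: I_def)
    then have tF: "is_tree R F" and R: "R \<subseteq> {..<n}" and FE: "F \<subseteq> E" and adjF: "adjacency n s' F"
      and tabF: "table n s' R F g" and vals: "s' ''i'' 0 = int i" "s' ''v'' 0 = int v"
        "s' ''r'' 0 = int r" "s' ''nodes'' 0 = int n"
      and rR: "r \<in> R" and iv: "i < n \<and> v < n \<or> i = n \<and> v = n"
      and leaf: "\<And>x. card (neighbors F x) = 1 \<Longrightarrow> i < x \<or> x = v"
      and w: "\<And>b. weight b g R F = weight b f {..<n} E"
      and time: "\<tau>' + (n - i) * (30 * K) + card F * (260 * K) \<le> B"
      by (simp_all add: G_def)
    have less: "i < n" "v < n" using 3(2) vals iv by auto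
    have gF: "simple_graph R F" using tF by (simp add: is_tree_def)
    have le: "card (neighbors F x) \<le> card (neighbors E x)" for x
      by (rule card_mono[OF finite_neighbors[OF gE] neighbors_mono[OF FE]])
    have D: "s' ''D'' (int v) = int (card (neighbors F v))"
      using adjF less by (simp add: adjacency_def)
    show ?case
    proof (rule wp_If, goal_cases)
      case 1
      then have one: "card (neighbors F v) = 1" using vals D by simp
      then obtain u where nb: "neighbors F v = {u}" by (rule card_1_singletonE)
      note p = is_tree_prune[OF tF nb]
      have uv: "u \<noteq> v" and uR: "u \<in> R" using p(2) by auto
      have "card F = Suc (card (F - {{u, v}}))"
        using p(4) finite_edges[OF gF] by (metis card_Suc_Diff1)
      then have cF: "card F * (260 * K) = card (F - {{u, v}}) * (260 * K) + 260 * K" by simp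
      show ?case
      proof (rule wp_prune[where s = s', OF vals(4) tF R adjF tabF vals(2) nb _ _ K], goal_cases)
        case (1 x) then show ?case using le[of x] degn[of x] by simp
      next
        case (2 x) then show ?case using le[of x] deg[of x] by simp
      next
        case (3 s'' \<tau>'')
        \<comment> \<open>\<open>v\<close> becomes isolated and only \<open>u\<close> loses a
          neighbor otherwise, so \<open>u\<close> is the only possible new leaf, and it is the next
          current node.\<close>
        have "i < x \<or> x = u" if x: "card (neighbors (F - {{u, v}}) x) = 1" for x
        proof (cases "x = u \<or> x = v")
          case True
          have "neighbors (F - {{u, v}}) v = {}" using nb by (auto simp: neighbors_def)
          then show ?thesis using True x by auto
        next
          case False
          then have "neighbors (F - {{u, v}}) x = neighbors F x"
            by (auto simp: neighbors_def doubleton_eq_iff)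
          then show ?thesis using leaf[of x] x False by simp
        qed
        moreover have "weight b (g(u := \<lambda>m. g v 0 * g u m + g v 1 * g u (Suc m))) (R - {v}) (F - {{u, v}})
            = weight b f {..<n} E" for b
          using weight_prune[OF gF nb p(3) uR uv] w by simp
        moreover have "\<tau>'' + (n - i) * (30 * K) + card (F - {{u, v}}) * (260 * K) \<le> B"
          using 3(6) time cF K by simp
        ultimately have "G s'' \<tau>'' (R - {v}) (F - {{u, v}})
            (g(u := \<lambda>m. g v 0 * g u m + g v 1 * g u (Suc m))) i u u"
          unfolding G_def using p(1,2) R FE 3(1-4) 3(5)[of "''nodes''"] 3(5)[of "''i''"] vals less uR by auto
        then show ?case by (rule IG)
      qed
    next
      case 2
      then have not_one: "card (neighbors F v) \<noteq> 1" using vals D by auto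
      obtain j where j: "n - i = Suc j" "n - Suc i = j" using less(1) by (metis Suc_diff_Suc)
      have "G (s'(''i'' := (s' ''i'')(0 := int i + 1), ''v'' := (s' ''v'')(0 := int i + 1)))
          (\<tau>' + 29) R F g (Suc i) (Suc i) r"
        unfolding G_def
      proof (intro conjI allI impI)
        show "Suc i < x \<or> x = Suc i" if "card (neighbors F x) = 1" for x
          using leaf[OF that] not_one that by (metis Suc_lessI)
        show "\<tau>' + 29 + (n - Suc i) * (30 * K) + card F * (260 * K) \<le> B"
          using time K unfolding j by simp
      qed (use tF R FE adjF tabF vals rR w less in \<open>auto simp: adjacency_def table_def\<close>)
      from IG[OF this] show ?case
        by (intro wp_Seq wp_Write) (simp add: vals numeral_eq_Suc add.commute)
    qed
  next
    case (4 s' \<tau>')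
    then obtain R F g i v r where G: "G s' \<tau>' R F g i v r" by (auto simp: I_def)
    then have tF: "is_tree R F" and R: "R \<subseteq> {..<n}"
      and tabF: "table n s' R F g" and vals: "s' ''v'' 0 = int v"
        "s' ''r'' 0 = int r" "s' ''nodes'' 0 = int n"
      and rR: "r \<in> R" and iv: "i < n \<and> v < n \<or> i = n \<and> v = n"
      and leaf: "\<And>x. card (neighbors F x) = 1 \<Longrightarrow> i < x \<or> x = v"
      and w: "\<And>b. weight b g R F = weight b f {..<n} E"
      and time: "\<tau>' \<le> B"
      by (simp_all add: G_def)
    have "i = n" "v = n" using 4(2) vals iv by auto
    \<comment> \<open>With \<open>i = v = n\<close> the invariant allows no leaf below
      \<open>n\<close>, while a tree with an edge has one.\<close>
    have "F = {}"
    proof (rule ccontr)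
      assume "F \<noteq> {}"
      with tF obtain x where x: "card (neighbors F x) = 1"
        using exists_leaf unfolding is_tree_def by metis
      then obtain u where "neighbors F x = {u}" by (rule card_1_singletonE)
      then have "x < n" using is_tree_prune(3)[OF tF] R by blast
      with leaf[OF x] \<open>i = n\<close> \<open>v = n\<close> show False by simp
    qed
    with tF have "is_tree R {}" by simp
    then have "R = {r}" using rR by (rule is_tree_no_edges)
    have "\<forall>m\<le>card (neighbors F r). s' ''P'' (int r * int n + int m) = g r m"
      using tabF rR unfolding table_def by (rule bspec)
    from this[rule_format, of 0] have "weight b f {..<n} E = 2 * s' ''P'' (s' ''r'' 0 * int n)" for b
      using w[of b] weight_singleton[of b g r] \<open>F = {}\<close> \<open>R = {r}\<close> vals by simp
    moreover have "\<tau>' + 6 \<le> \<tau> + 320 * (n * K)"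
    proof -
      have "card E * K \<le> n * K" "1 \<le> n * K" using card K by auto
      moreover have "\<tau>' \<le> \<tau> + 20 + 30 * (n * K) + 260 * (card E * K)"
        using time by (simp add: B_def algebra_simps)
      ultimately show ?thesis by linarith
    qed
    ultimately show ?case using vals by (intro Q) simp_all
  qed
qed

text \<open>The final result does not depend on \<open>b\<close>: exchanging the colors of one side of the
  bipartition of the tree turns good neighbors into bad ones.\<close>

lemma wp_count:
  assumes t: "is_tree {..<n} E" and es: "edge_list E es" and n: "s ''nodes'' 0 = int n"
    and src: "s ''source'' = array_of (map fst es)" and tgt: "s ''target'' = array_of (map snd es)"
    and K: "1 \<le> K" and deg: "\<And>x. x < n \<Longrightarrow> card (neighbors E x) \<le> K"
    and Q: "\<And>s' \<tau>'. (\<And>b. s' x 0 = weight b (threshold \<theta> E) {..<n} E) \<Longrightarrow>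
      (\<And>y. y \<notin> writes (count (int \<theta>) x) \<Longrightarrow> s' y = s y) \<Longrightarrow>
      \<tau>' \<le> \<tau> + 1000 * (n * K) \<Longrightarrow> Q s' \<tau>'"
  shows "wp (count (int \<theta>) x) Q s \<tau>"
proof -
  have g: "simple_graph {..<n} E" using t by (simp add: is_tree_def)
  have degn: "card (neighbors E x) < n" if "x < n" for x
    using card_mono[OF _ neighbors_subset[OF g, of x]] that by simp
  have n1: "1 \<le> n" using is_tree_card[OF t] by simp
  have nK: "n \<le> n * K" "K \<le> n * K" "1 \<le> n * K" using n1 K by simp_all
  have "wp (count (int \<theta>) x) (\<lambda>s' \<tau>'. (\<forall>b. s' x 0 = weight b (threshold \<theta> E) {..<n} E) \<and>
      \<tau>' \<le> \<tau> + 1000 * (n * K)) s \<tau>"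
    unfolding count_def
  proof (rule wp_Seq, rule wp_clear[where n = n and s = s, OF n], goal_cases)
    case (1 s1 \<tau>1)
    note c1 = this
    show ?case
    proof (rule wp_Seq, rule wp_load[where s = s1, OF _ t es _ _ c1(1)], goal_cases)
      case (4 s2 \<tau>2)
      note c2 = this
      show ?case
      proof (rule wp_Seq, rule wp_weights[where s = s2, OF _ c2(1) degn deg], goal_cases)
        case (4 s3 \<tau>3)
        note c3 = this
        have n3: "s3 ''nodes'' 0 = int n" using c1(2) c2(2) c3(2) n by simp
        have a3: "adjacency n s3 E" using c2(1) c3(2) by (simp add: adjacency_def)
        show ?case
        proof (rule wp_Seq, rule wp_prune_all[where s = s3, OF n3 t a3 c3(1) deg K], goal_cases)
          case (2 s4 \<tau>4)
          note c4 = this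
          have "\<tau>1 \<le> \<tau> + 27 + 26 * n" using c1(3) by simp
          moreover have "\<tau>3 \<le> \<tau>2 + 42 * (n * K) + 42 * K + 101 * n + 102"
            using c3(3) by (simp add: algebra_simps)
          ultimately have "\<tau>4 + 20 \<le> \<tau> + 1000 * (n * K)"
            using c2(3) c4(3) nK by linarith
          then show ?case using c4(1,2) by (intro wp_Write) simp
        qed
      qed (use c1 c2 n in simp_all)
    qed (use c1 n src tgt in simp_all)
  qed
  then show ?thesis by (rule wp_frame) (use Q in blast)
qed

theorem theorem1:
  fixes M :: "nat set \<Rightarrow> nat set set \<Rightarrow> nat coloring \<Rightarrow> nat coloring"
  assumes "M = minority \<or> M = majority"
  shows "\<exists>(p :: com) (C :: nat). \<forall>(n :: nat) (E :: nat set set) (es :: (nat \<times> nat) list).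
    is_tree {..<n} E \<and> edge_list E es \<longrightarrow>
    (\<exists>t s. exec p (input_state n es) t s \<and>
       s ''fixed_points'' 0 = int (card (fixed_points {..<n} (M {..<n} E))) \<and>
       s ''pure_two_cycles'' 0 = int (card (pure_two_cycles {..<n} (M {..<n} E))) \<and>
       t \<le> C * (n * max 1 (max_degree {..<n} E)))"
proof (rule exI[of _ "Seq (count (int 0) ''fixed_points'') (count (int 1) ''pure_two_cycles'')"],
    rule exI[of _ 2001], intro allI impI)
  fix n :: nat and E :: "nat set set" and es :: "(nat \<times> nat) list"
  assume "is_tree {..<n} E \<and> edge_list E es"
  then have t: "is_tree {..<n} E" and es: "edge_list E es" by auto
  \<comment> \<open>A single node has maximal degree 0 although the program still takes time, hence
    the maximum with 1.\<close>
  define K where "K = max 1 (max_degree {..<n} E)"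
  have g: "simple_graph {..<n} E" using t by (simp add: is_tree_def)
  have K: "1 \<le> K" by (simp add: K_def)
  have deg: "card (neighbors E x) \<le> K" if "x < n" for x
    unfolding K_def max_degree_def using that by (intro max.coboundedI2 Max_ge) auto
  have "1 \<le> n" using is_tree_card[OF t] by simp
  then have nK: "1 \<le> n * K" using K by simp
  obtain b where b: "\<And>c. c \<in> colorings {..<n} \<Longrightarrow> M {..<n} E c = switch b {..<n} E c"
    using assms switch_minority[OF g] switch_majority[OF g] by metis
  let ?s = "input_state n es"
  have inp: "?s ''nodes'' 0 = int n" "?s ''source'' = array_of (map fst es)"
    "?s ''target'' = array_of (map snd es)"
    by (simp_all add: input_state_def array_of_def)
  have "wp (Seq (count (int 0) ''fixed_points'') (count (int 1) ''pure_two_cycles''))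
      (\<lambda>s \<tau>. s ''fixed_points'' 0 = int (card (fixed_points {..<n} (M {..<n} E))) \<and>
        s ''pure_two_cycles'' 0 = int (card (pure_two_cycles {..<n} (M {..<n} E))) \<and>
        \<tau> \<le> 2001 * (n * K)) ?s 0"
  proof (rule wp_Seq, rule wp_count[where s = ?s, OF t es inp K deg], goal_cases)
    case (2 s1 \<tau>1)
    note c1 = this
    have fr1: "s1 y = ?s y" if "y \<in> {''nodes'', ''source'', ''target''}" for y
      using that by (intro c1(2)) (auto simp: count_def clear_def load_def weights_def
          prune_all_def prune_def update_def)
    show ?case
    proof (rule wp_count[where s = s1, OF t es _ _ _ K deg], goal_cases)
      case (5 s2 \<tau>2)
      have "s2 ''fixed_points'' = s1 ''fixed_points''"
        by (intro 5(2)) (auto simp: count_def clear_def load_def weights_def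
          prune_all_def prune_def update_def)
      \<comment> \<open>Each of the two counts takes at most \<open>1000 * (n * K)\<close>, and the
        outer \<open>Seq\<close> takes one more unit.\<close>
      moreover have "\<tau>2 \<le> 2001 * (n * K)" using c1(3) 5(3) nK by linarith
      \<comment> \<open>The program never refers to \<open>b\<close>: the first result is read with
        \<open>b\<close>, the second with \<open>\<not> b\<close>, so one program serves both
        processes.\<close>
      ultimately show ?case
        using c1(1)[of b] 5(1)[of "\<not> b"]
        by (simp add: card_fixed_points_switch[OF g b] card_pure_two_cycles_switch[OF g b])
    qed (use inp fr1 in simp_all)
  qed
  then show "\<exists>t s. exec (Seq (count (int 0) ''fixed_points'') (count (int 1) ''pure_two_cycles''))
      ?s t s \<and> s ''fixed_points'' 0 = int (card (fixed_points {..<n} (M {..<n} E))) \<and>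
      s ''pure_two_cycles'' 0 = int (card (pure_two_cycles {..<n} (M {..<n} E))) \<and>
      t \<le> 2001 * (n * max 1 (max_degree {..<n} E))"
    unfolding wp_def K_def by auto
qed

end
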